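(* Let $H$ be the fundamental sequence of the periodic Zeckendorf collection for positive integers determined by $L=(e_1,\dots,e_N)$, let $f(x)=x^N-\sum_{k=1}^{N-1}e_kx^{N-k}-(1+e_N)$, and let $\phi$ be its unique positive real zero. Then $$\lim_{n\to\infty}\frac{H_n}{\phi^{n-1}}=\frac{1}{f'(\phi)}\sum_{k=1}^{N}\frac{H_k}{(k-1)!}\left[\frac{d^{k-1}}{dx^{k-1}}\frac{f(x)}{x-\phi}\right]_{x=0}.$$ If moreover $H_k=B^{k-1}$ for $1\le k\le N$ for some number $B\ne\phi$, then $\lim_{n\to\infty}H_n/\phi^{n-1}=\dfrac{f(B)}{(B-\phi)f'(\phi)}$.
   Context: A coefficient function is a sequence $\mu=(\mu_1,\mu_2,\dots)$ of non-negative integers. For a sequence $G$, $\sum\mu G:=\sum_{k\ge1}\mu_kG_k$. For $n\ge1$, $\mathrm{rev}_n(\mu)=(\mu_n,\mu_{n-1},\dots,\mu_1,0,0,\dots)$. For a list $L=(e_1,\dots,e_N)$ of non-negative integers with $N\ge2$, $e_1\ne0$, let $\beta^*$ be the coefficient function with $\beta^*_k=e_j$ whenever $k\equiv j\pmod N$, $1\le j\le N$, and for $n\ge2$ let $\theta^n=\mathrm{rev}_{n-1}(\beta^* )$. The fundamental sequence of the periodic Zeckendorf collection for positive integers determined by $L$ is the sequence $H$ with $H_1=1$ and $H_n=1+\sum\theta^nH$ for $n\ge2$; it satisfies $H_n=\sum_{k=1}^{N-1}e_kH_{n-k}+(1+e_N)H_{n-N}$ for $n>N$. The polynomial $f$ has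 a unique positive zero $\phi>1$, which is simple and is the unique zero of largest modulus. *)

theory Defs
  imports "HOL-Analysis.Analysis" "HOL-Computational_Algebra.Polynomial"
    "HOL-Number_Theory.Cong"
begin

text \<open>
  Coefficient functions and the sequences they are paired with are functions on \<^typ>\<open>nat\<close> of which
  only the values at indices \<open>k \<ge> 1\<close> are meaningful. A list \<open>(e\<^sub>1, \<dots>, e\<^sub>N)\<close> is a \<^typ>\<open>nat list\<close> \<open>L\<close>
  with \<open>e\<^sub>j = L ! (j - 1)\<close>.
\<close>

text \<open>
  The sum over all \<open>k \<ge> 1\<close> is taken over the support of \<open>\<mu>\<close>; it has its intended meaning for
  finitely supported \<open>\<mu>\<close>, which covers every \<open>rev_coeff n \<mu>\<close>.
\<close>

definition coeff_sum :: "(nat \<Rightarrow> nat) \<Rightarrow> (nat \<Rightarrow> nat) \<Rightarrow> nat" where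
  "coeff_sum \<mu> G = (\<Sum>k | 1 \<le> k \<and> \<mu> k \<noteq> 0. \<mu> k * G k)"

definition rev_coeff :: "nat \<Rightarrow> (nat \<Rightarrow> nat) \<Rightarrow> nat \<Rightarrow> nat" where
  "rev_coeff n \<mu> k = (if 1 \<le> k \<and> k \<le> n then \<mu> (n + 1 - k) else 0)"

definition beta_star :: "nat list \<Rightarrow> nat \<Rightarrow> nat" where
  "beta_star L k = (if k = 0 then 0 else L ! ((k - 1) mod length L))"

definition theta :: "nat list \<Rightarrow> nat \<Rightarrow> nat \<Rightarrow> nat" where
  "theta L n = rev_coeff (n - 1) (beta_star L)"

definition is_fundamental_seq :: "nat list \<Rightarrow> (nat \<Rightarrow> nat) \<Rightarrow> bool" where
  "is_fundamental_seq L H \<longleftrightarrow>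
     H 1 = 1 \<and> (\<forall>n\<ge>2. H n = 1 + coeff_sum (theta L n) H)"

definition zeck_poly :: "nat list \<Rightarrow> real poly" where
  "zeck_poly L =
     monom 1 (length L)
     - (\<Sum>k = 1..length L - 1. monom (real (L ! (k - 1))) (length L - k))
     - [:1 + real (L ! (length L - 1)):]"

definition pos_zero :: "nat list \<Rightarrow> real" where
  "pos_zero L = (THE x. 0 < x \<and> poly (zeck_poly L) x = 0)"

lemma beta_star_eq:
  assumes "[k = j] (mod length L)" "1 \<le> k" "1 \<le> j" "j \<le> length L"
  shows "beta_star L k = L ! (j - 1)"
proof -
  have "[k - 1 = j - 1] (mod length L)"
    using assms(1-3) by (metis cong_add_rcancel_nat le_add_diff_inverse2)
  then have "(k - 1) mod length L = (j - 1) mod length L"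
    by (simp add: cong_def)
  also have "\<dots> = j - 1"
    using assms(3,4) by simp
  finally show ?thesis
    using assms(2) by (simp add: beta_star_def)
qed

lemma coeff_sum_theta:
  assumes "2 \<le> n"
  shows "coeff_sum (theta L n) H = (\<Sum>k = 1..<n. beta_star L (n - k) * H k)"
proof -
  have "coeff_sum (theta L n) H = (\<Sum>k = 1..<n. theta L n k * H k)"
    unfolding coeff_sum_def
    by (rule sum.mono_neutral_left) (auto simp: theta_def rev_coeff_def split: if_splits)
  also have "\<dots> = (\<Sum>k = 1..<n. beta_star L (n - k) * H k)"
    using assms by (intro sum.cong) (auto simp: theta_def rev_coeff_def)
  finally show ?thesis .
qed

fun fund_seq :: "nat list \<Rightarrow> nat \<Rightarrow> nat" where
  "fund_seq L n = 1 + (\<Sum>k = 1..<n. beta_star L (n - k) * fund_seq L k)"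

declare fund_seq.simps [simp del]

lemma fund_seq_1: "fund_seq L 1 = 1"
  by (subst fund_seq.simps) simp

lemma is_fundamental_seq_fund_seq: "is_fundamental_seq L (fund_seq L)"
  unfolding is_fundamental_seq_def
proof (intro conjI allI impI)
  show "fund_seq L 1 = 1"
    by (fact fund_seq_1)
  show "fund_seq L n = 1 + coeff_sum (theta L n) (fund_seq L)" if "2 \<le> n" for n
    by (simp only: coeff_sum_theta [OF that]) (rule fund_seq.simps)
qed

lemma is_fundamental_seq_unique:
  assumes "is_fundamental_seq L H" "1 \<le> n"
  shows "H n = fund_seq L n"
  using assms(2)
proof (induction n rule: less_induct)
  case (less n)
  show ?case
  proof (cases "n = 1")
    case True
    then show ?thesis
      using assms(1) fund_seq_1 by (simp add: is_fundamental_seq_def)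
  next
    case False
    with less.prems have "2 \<le> n" by simp
    then have "H n = 1 + (\<Sum>k = 1..<n. beta_star L (n - k) * H k)"
      using assms(1) by (simp add: is_fundamental_seq_def coeff_sum_theta)
    also have "(\<Sum>k = 1..<n. beta_star L (n - k) * H k)
        = (\<Sum>k = 1..<n. beta_star L (n - k) * fund_seq L k)"
      using less.IH by (intro sum.cong) auto
    finally show ?thesis
      by (simp only: fund_seq.simps [of L n])
  qed
qed

lemma poly_zeck_poly:
  "poly (zeck_poly L) x =
     x ^ length L - (\<Sum>k = 1..length L - 1. real (L ! (k - 1)) * x ^ (length L - k))
     - (1 + real (L ! (length L - 1)))"
  by (simp add: zeck_poly_def poly_sum poly_monom)

lemma zeck_poly_ex1_pos_zero:
  assumes "2 \<le> length L" "L ! 0 \<noteq> 0"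
  shows "\<exists>!x. 0 < x \<and> poly (zeck_poly L) x = 0"
    and "1 < pos_zero L"
proof -
  define N where "N = length L"
  define S where
    "S x = (\<Sum>k = 1..N - 1. real (L ! (k - 1)) * x ^ (N - k)) + (1 + real (L ! (N - 1)))"
    for x :: real
  have f: "poly (zeck_poly L) x = x ^ N - S x" for x
    by (simp add: poly_zeck_poly S_def N_def)
  have S_le: "S (t * x) \<le> t ^ (N - 1) * S x" if "1 \<le> t" "0 < x" for t x
  proof -
    have "(\<Sum>k = 1..N - 1. real (L ! (k - 1)) * (t * x) ^ (N - k))
        \<le> (\<Sum>k = 1..N - 1. t ^ (N - 1) * (real (L ! (k - 1)) * x ^ (N - k)))"
    proof (rule sum_mono)
      fix k assume "k \<in> {1..N - 1}"
      then have "t ^ (N - k) \<le> t ^ (N - 1)"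
        using that by (intro power_increasing) auto
      then have "t ^ (N - k) * (real (L ! (k - 1)) * x ^ (N - k))
          \<le> t ^ (N - 1) * (real (L ! (k - 1)) * x ^ (N - k))"
        using that by (intro mult_right_mono) auto
      then show "real (L ! (k - 1)) * (t * x) ^ (N - k)
          \<le> t ^ (N - 1) * (real (L ! (k - 1)) * x ^ (N - k))"
        by (simp add: power_mult_distrib mult_ac)
    qed
    moreover have "1 * (1 + real (L ! (N - 1))) \<le> t ^ (N - 1) * (1 + real (L ! (N - 1)))"
      using that by (intro mult_right_mono) (auto simp: one_le_power)
    ultimately show ?thesis
      by (simp add: S_def sum_distrib_left distrib_left)
  qed
  have pow: "t ^ N = t * t ^ (N - 1)" for t :: real
    using assms(1) by (metis N_def One_nat_def Suc_1 Suc_le_lessD Suc_pred less_Suc_eq_0_disj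
        less_le_trans power_Suc zero_less_Suc zero_less_diff)
  have S1: "1 < S 1"
  proof -
    have "0 < real (L ! (1 - 1))"
      using assms(2) by simp
    also have "\<dots> \<le> (\<Sum>k = 1..N - 1. real (L ! (k - 1)))"
      using assms(1) by (intro member_le_sum) (auto simp: N_def)
    finally show ?thesis
      by (simp add: S_def)
  qed
  obtain r where r: "1 < r" "poly (zeck_poly L) r = 0"
  proof -
    define M where "M = S 1 + 1"
    have "S (M * 1) \<le> M ^ (N - 1) * S 1"
      using S1 by (intro S_le) (auto simp: M_def)
    also have "\<dots> < M ^ (N - 1) * M"
      using S1 by (intro mult_strict_left_mono) (auto simp: M_def)
    finally have "0 < poly (zeck_poly L) M"
      by (simp add: f pow mult.commute)
    moreover have "poly (zeck_poly L) 1 < 0"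
      using S1 by (simp add: f)
    moreover have "1 < M"
      using S1 by (simp add: M_def)
    ultimately show ?thesis
      using poly_IVT_pos that by blast
  qed
  have no_larger: False
    if "0 < x" "x < y" "poly (zeck_poly L) x = 0" "poly (zeck_poly L) y = 0" for x y
  proof -
    define t where "t = y / x"
    have t: "1 < t" "y = t * x"
      using that by (auto simp: t_def)
    have "(t * x) ^ N = S (t * x)"
      using that t by (simp add: f)
    also have "\<dots> \<le> t ^ (N - 1) * S x"
      using t that by (intro S_le) auto
    also have "\<dots> = t ^ (N - 1) * x ^ N"
      using that by (simp add: f)
    also have "\<dots> < t ^ N * x ^ N"
      using t that by (intro mult_strict_right_mono) (auto simp: pow)
    finally show False
      by (simp add: power_mult_distrib)
  qed
  show ex1: "\<exists>!x. 0 < x \<and> poly (zeck_poly L) x = 0"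
  proof (rule ex1I [of _ r])
    show "0 < r \<and> poly (zeck_poly L) r = 0"
      using r by simp
    show "y = r" if "0 < y \<and> poly (zeck_poly L) y = 0" for y
      using no_larger [of y r] no_larger [of r y] that r by fastforce
  qed
  have "pos_zero L = r"
    unfolding pos_zero_def using ex1 r by (intro the1_equality) auto
  with r show "1 < pos_zero L"
    by simp
qed

end

theory Submission
  imports Defs
begin

text \<open>
  Write \<open>f = (x - \<phi>) q\<close> with \<open>q = \<Sum>j<N. q\<^sub>j x\<^sup>j\<close>, and let \<open>T\<^sub>n = \<Sum>j<N. q\<^sub>j H\<^sub>n\<^sub>+\<^sub>j\<close>. The recurrence of
  \<open>H\<close> says \<open>T\<^sub>n\<^sub>+\<^sub>1 = \<phi> T\<^sub>n\<close>, so the normalised terms \<open>g\<^sub>n = H\<^sub>n / \<phi>\<^sup>n\<^sup>-\<^sup>1\<close> have the constant weighted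
  mean \<open>T\<^sub>1 / q(\<phi>)\<close> over each window of length \<open>N\<close>, with weights proportional to \<open>q\<^sub>j \<phi>\<^sup>j > 0\<close>.
  On the other hand each \<open>g\<^sub>n\<close> is a convex combination of the \<open>N\<close> preceding terms in which the first
  and the last weights are positive; this contracts the deviation from the mean, so \<open>g\<close> tends
  to \<open>T\<^sub>1 / q(\<phi>) = T\<^sub>1 / f'(\<phi>)\<close>. Only the positivity of the weights is used, no other zero of \<open>f\<close>.
\<close>

section \<open>Contraction of averaging recurrences\<close>

text \<open>The zero mean supplies a nonnegative term in each window of length \<open>N\<close>. Its
  excess over \<open>- A\<close> is carried \<open>N\<close> places forward with factor
  \<open>a 0\<close>, then from neighbour to neighbour with factor \<open>a (N - 1)\<close>, so a
  fixed fraction of it survives at \<open>k\<close>.\<close>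

lemma averaging_step_lower_bound:
  fixes D a w :: "nat \<Rightarrow> real"
  assumes N: "N \<ge> 1"
    and a_nonneg: "\<And>i. i < N \<Longrightarrow> 0 \<le> a i"
    and a_sum: "(\<Sum>i<N. a i) = 1"
    and rec: "\<And>n. D (n + N) = (\<Sum>i<N. a i * D (n + i))"
    and w_pos: "\<And>j. j < N \<Longrightarrow> 0 < w j"
    and mean: "\<And>n. (\<Sum>j<N. w j * D (n + j)) = 0"
    and bound: "\<And>k. n \<le> k \<Longrightarrow> - A \<le> D k"
    and k: "n + 2 * N \<le> k"
  shows "- (1 - a 0 * a (N - 1) ^ N) * A \<le> D k"
proof -
  have a_le_1: "a i \<le> 1" if "i < N" for i
    using member_le_sum[of i "{..<N}" a] a_nonneg a_sum that by auto
  have step: "- A + a i * (D (m + i) + A) \<le> D (m + N)" if "n \<le> m" "i < N" for m i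
  proof -
    have "a i * (D (m + i) + A) \<le> (\<Sum>j<N. a j * (D (m + j) + A))"
    proof (rule member_le_sum)
      show "0 \<le> a j * (D (m + j) + A)" if "j \<in> {..<N} - {i}" for j
        using that a_nonneg[of j] bound[of "m + j"] \<open>n \<le> m\<close> by simp
    qed (use that in auto)
    also have "\<dots> = D (m + N) + A"
      by (simp add: rec distrib_left sum.distrib flip: sum_distrib_right) (simp add: a_sum)
    finally show ?thesis by simp
  qed
  \<comment> \<open>From a term at \<open>m + j\<close>, one jump of \<open>N\<close> and
    \<open>N - j\<close> single steps end exactly at \<open>k\<close>, whatever \<open>j < N\<close>
    is.\<close>
  define m where "m = k - 2 * N"
  have "\<exists>j<N. 0 \<le> D (m + j)"
  proof (rule ccontr)
    assume "\<not> ?thesis"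
    then have "(\<Sum>j<N. w j * D (m + j)) < (\<Sum>j<N. 0)"
      using N w_pos by (intro sum_strict_mono) (auto simp: mult_less_0_iff not_le lessThan_empty_iff)
    then show False using mean by simp
  qed
  then obtain j where j: "j < N" "0 \<le> D (m + j)" by blast
  have n: "n \<le> m" using k by (simp add: m_def)
  have A: "0 \<le> A + D (m + j)" using bound[of "m + j"] n by simp
  have run: "- A + a (N - 1) ^ r * (a 0 * (D (m + j) + A)) \<le> D (m + j + N + r)" for r
  proof (induction r)
    case 0
    show ?case using step[of "m + j" 0] n N by simp
  next
    case (Suc r)
    have "- A + a (N - 1) ^ Suc r * (a 0 * (D (m + j) + A))
        \<le> - A + a (N - 1) * (D (m + j + N + r) + A)"
      using mult_left_mono[OF Suc.IH, of "a (N - 1)"] a_nonneg[of "N - 1"] N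
      by (simp add: algebra_simps)
    also have "\<dots> \<le> D (m + j + N + Suc r)"
      using step[of "m + j + r + 1" "N - 1"] n N by (simp add: algebra_simps)
    finally show ?case .
  qed
  define r where "r = N - j"
  have k_eq: "k = m + j + N + r"
    using k j by (simp add: m_def r_def)
  show ?thesis
  \<comment> \<open>The sign of \<open>A\<close> is not prescribed. For negative \<open>A\<close>
    the claim is weaker than \<open>bound\<close>; otherwise \<open>r \<le> N\<close> and
    \<open>a (N - 1) \<le> 1\<close> allow \<open>r\<close> to be replaced by
    \<open>N\<close>.\<close>
  proof (cases "0 \<le> A")
    case True
    have "a (N - 1) ^ N * (a 0 * A) \<le> a (N - 1) ^ r * (a 0 * (D (m + j) + A))"
      using N j True a_nonneg a_le_1
      by (intro mult_mono power_decreasing) (auto simp: r_def)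
    then show ?thesis
      using run[of r] k_eq by (simp add: algebra_simps)
  next
    case False
    have "a 0 * a (N - 1) ^ N \<ge> 0" using a_nonneg N by simp
    then have "a 0 * a (N - 1) ^ N * A \<le> 0" using False by (simp add: mult_nonneg_nonpos)
    then show ?thesis
      using bound[of k] k by (simp add: algebra_simps)
  qed
qed

text \<open>The one-sided bound, applied to \<open>D\<close> and to \<open>- D\<close>, shrinks the
  bound on the absolute values by a factor \<open>c < 1\<close> over every \<open>2 * N\<close>
  indices. Positive end weights give \<open>c < 1\<close>.\<close>

lemma averaging_tendsto_0:
  fixes D a w :: "nat \<Rightarrow> real"
  assumes N: "N \<ge> 1"
    and a_nonneg: "\<And>i. i < N \<Longrightarrow> 0 \<le> a i"
    and a_ends: "0 < a 0" "0 < a (N - 1)"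
    and a_sum: "(\<Sum>i<N. a i) = 1"
    and rec: "\<And>n. D (n + N) = (\<Sum>i<N. a i * D (n + i))"
    and w_pos: "\<And>j. j < N \<Longrightarrow> 0 < w j"
    and mean: "\<And>n. (\<Sum>j<N. w j * D (n + j)) = 0"
  shows "D \<longlonglongrightarrow> 0"
proof -
  define A where "A = (\<Sum>i<N. \<bar>D i\<bar>)"
  define c where "c = 1 - a 0 * a (N - 1) ^ N"
  \<comment> \<open>A convex combination never exceeds the bound on the terms it combines, so the
    initial window controls everything.\<close>
  have bounded: "\<bar>D k\<bar> \<le> A" for k
  proof (induction k rule: less_induct)
    case (less k)
    show ?case
    proof (cases "k < N")
      case True
      then show ?thesis unfolding A_def by (intro member_le_sum) auto
    next
      case False
      then have "D k = (\<Sum>i<N. a i * D (k - N + i))" using rec[of "k - N"] by simp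
      also have "\<bar>\<dots>\<bar> \<le> (\<Sum>i<N. a i * A)"
        using a_nonneg less.IH False
        by (intro order.trans[OF sum_abs] sum_mono) (auto simp: abs_mult intro!: mult_mono)
      also have "\<dots> = A" by (simp add: a_sum flip: sum_distrib_right)
      finally show ?thesis .
    qed
  qed
  have shrink: "\<bar>D k\<bar> \<le> c ^ m * A" if "2 * N * m \<le> k" for k m
    using that
  proof (induction m arbitrary: k)
    case 0
    then show ?case using bounded by simp
  next
    case (Suc m)
    have le: "2 * N * m + 2 * N \<le> k" using Suc.prems by simp
    have "- c * (c ^ m * A) \<le> D k"
      unfolding c_def
      by (rule averaging_step_lower_bound[OF N a_nonneg a_sum rec w_pos mean _ le])
        (use Suc.IH in \<open>auto simp: c_def abs_le_iff minus_le_iff\<close>)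
    moreover have "- c * (c ^ m * A) \<le> - D k"
      unfolding c_def
      by (rule averaging_step_lower_bound
          [where D = "\<lambda>k. - D k", OF N a_nonneg a_sum _ w_pos _ _ le])
        (use Suc.IH rec mean in \<open>auto simp: c_def abs_le_iff minus_le_iff sum_negf\<close>)
    ultimately show ?case by (simp add: abs_le_iff)
  qed
  have a_le_1: "a i \<le> 1" if "i < N" for i
    using member_le_sum[of i "{..<N}" a] a_nonneg a_sum that by auto
  have c: "0 \<le> c" "c < 1"
    using a_ends a_le_1 N by (auto simp: c_def intro!: mult_le_one power_le_one)
  have "LIM k sequentially. k div (2 * N) :> at_top"
    using N by (intro filterlim_at_top_div_const_nat) auto
  then have "(\<lambda>k. c ^ (k div (2 * N)) * A) \<longlonglongrightarrow> 0"
    using c by (auto intro!: tendsto_mult_left_zero filterlim_compose[OF LIMSEQ_realpow_zero])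
  moreover have "\<bar>D k\<bar> \<le> c ^ (k div (2 * N)) * A" for k
    by (rule shrink) simp
  ultimately show ?thesis
    by (intro Lim_null_comparison[of D]) auto
qed

section \<open>Linear recurrences normalised by a positive zero\<close>

text \<open>The coefficient signs turn the normalised recurrence into a convex combination with
  positive end weights and force the coefficients of \<open>q\<close> to be positive. Hence
  \<open>averaging_tendsto_0\<close> applies to the deviation from the claimed limit.\<close>

theorem linear_recurrence_dominant_limit:
  fixes f q :: "real poly" and h :: "nat \<Rightarrow> real"
  assumes N: "N \<ge> 1"
    and lead: "degree f = N" "coeff f N = 1"
    and nonpos: "\<And>i. i < N \<Longrightarrow> coeff f i \<le> 0"
    and neg: "coeff f 0 < 0" "coeff f (N - 1) < 0"
    and fact: "f = [:- \<phi>, 1:] * q" and \<phi>: "0 < \<phi>"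
    and rec: "\<And>n. (\<Sum>i\<le>N. coeff f i * h (n + i)) = 0"
  shows "(\<lambda>n. h n / \<phi> ^ n) \<longlonglongrightarrow> (\<Sum>j<N. coeff q j * h j) / poly (pderiv f) \<phi>"
proof -
  have "q \<noteq> 0" using fact lead by auto
  then have deg_q: "degree q = N - 1"
    using lead degree_mult_eq[of "[:- \<phi>, 1:]" q] fact by simp
  have q_N: "coeff q N = 0"
    using deg_q N by (intro coeff_eq_0) simp
  have f_0: "coeff f 0 = - \<phi> * coeff q 0" and
    f_Suc: "coeff f (Suc j) = coeff q j - \<phi> * coeff q (Suc j)" for j
    by (simp_all add: fact)
  \<comment> \<open>Synthetic division:
    \<open>\<phi> * coeff q (Suc j) = coeff q j - coeff f (Suc j)\<close>, where the subtracted
    coefficient is nonpositive.\<close>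
  have q_pos: "0 < coeff q j" if "j < N" for j
    using that
  proof (induction j)
    case 0
    then show ?case using f_0 neg(1) \<phi> by (simp add: zero_less_mult_iff)
  next
    case (Suc j)
    then have "0 < \<phi> * coeff q (Suc j)" using f_Suc[of j] nonpos[of "Suc j"] by simp
    then show ?case using \<phi> by (simp add: zero_less_mult_iff)
  qed
  have poly_q: "poly q x = (\<Sum>j<N. coeff q j * x ^ j)" for x
    using N by (simp add: poly_altdef deg_q flip: lessThan_Suc_atMost)
  have deriv: "poly (pderiv f) \<phi> = poly q \<phi>"
    unfolding fact pderiv_mult by (simp add: pderiv_pCons)
  have q_\<phi>_pos: "0 < poly q \<phi>"
    unfolding poly_q using q_pos \<phi> N by (intro sum_pos) (auto simp: lessThan_empty_iff)
  define T where "T n = (\<Sum>j<N. coeff q j * h (n + j))" for n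
  have T_Suc: "T (Suc n) = \<phi> * T n" for n
  proof -
    have "0 = coeff f 0 * h n + (\<Sum>j<N. coeff f (Suc j) * h (n + Suc j))"
      using rec[of n] by (simp add: sum.atMost_shift)
    also have "\<dots> = T (Suc n) - \<phi> * (coeff q 0 * h n + (\<Sum>j<N. coeff q (Suc j) * h (n + Suc j)))"
      by (simp add: f_0 f_Suc T_def algebra_simps sum_subtractf sum_distrib_left)
    also have "coeff q 0 * h n + (\<Sum>j<N. coeff q (Suc j) * h (n + Suc j))
        = (\<Sum>j\<le>N. coeff q j * h (n + j))"
      by (simp add: sum.atMost_shift)
    \<comment> \<open>The extra summand at \<open>j = N\<close> vanishes by
      \<open>q_N\<close>.\<close>
    also have "\<dots> = T n"
      by (simp add: T_def q_N flip: lessThan_Suc_atMost)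
    finally show ?thesis by simp
  qed
  have T: "T n = \<phi> ^ n * T 0" for n
    by (induction n) (auto simp: T_Suc)
  define l where "l = T 0 / poly q \<phi>"
  define D where "D n = h n / \<phi> ^ n - l" for n
  \<comment> \<open>Dividing the recurrence by \<open>\<phi> ^ (n + N)\<close> produces these
    weights; they sum to 1 because \<open>\<phi>\<close> is a zero of \<open>f\<close>.\<close>
  define a where "a i = - coeff f i * \<phi> ^ i / \<phi> ^ N" for i
  have a_sum: "(\<Sum>i<N. a i) = 1"
  proof -
    have "poly f \<phi> = 0" by (simp add: fact)
    then have "(\<Sum>i<N. coeff f i * \<phi> ^ i) = - (\<phi> ^ N)"
      using lead by (simp add: poly_altdef flip: lessThan_Suc_atMost)
    then show ?thesis
      using \<phi> by (simp add: a_def sum_negf flip: sum_divide_distrib)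
  qed
  have "D \<longlonglongrightarrow> 0"
  proof (rule averaging_tendsto_0[of N a D "\<lambda>j. coeff q j * \<phi> ^ j"])
    show "D (n + N) = (\<Sum>i<N. a i * D (n + i))" for n
    proof -
      have "h (n + N) = - (\<Sum>i<N. coeff f i * h (n + i))"
        using rec[of n] lead by (simp flip: lessThan_Suc_atMost)
      then have "h (n + N) / \<phi> ^ (n + N) = (\<Sum>i<N. a i * (h (n + i) / \<phi> ^ (n + i)))"
        using \<phi> by (simp add: a_def sum_divide_distrib power_add field_simps sum_negf)
      then show ?thesis
        by (simp add: D_def right_diff_distrib sum_subtractf flip: sum_distrib_right)
          (simp add: a_sum)
    qed
    show "(\<Sum>j<N. coeff q j * \<phi> ^ j * D (n + j)) = 0" for n
    proof -
      have "(\<Sum>j<N. coeff q j * \<phi> ^ j * (h (n + j) / \<phi> ^ (n + j))) = T n / \<phi> ^ n"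
        unfolding T_def sum_divide_distrib using \<phi> by (intro sum.cong) (auto simp: power_add)
      also have "\<dots> = poly q \<phi> * l"
        using T[of n] \<phi> q_\<phi>_pos by (simp add: l_def)
      finally show ?thesis
        by (simp add: D_def right_diff_distrib sum_subtractf poly_q flip: sum_distrib_right)
    qed
  qed (use N nonpos neg \<phi> q_pos a_sum in
      \<open>auto simp: a_def divide_nonpos_pos divide_neg_pos mult_nonpos_nonneg mult_neg_pos\<close>)
  then have "(\<lambda>n. h n / \<phi> ^ n) \<longlonglongrightarrow> l"
    unfolding D_def by (rule LIM_zero_cancel)
  then show ?thesis by (simp add: l_def T_def deriv)
qed

section \<open>Derivatives of the quotient, coefficients of the polynomial, recurrence of
  \<open>H\<close>\<close>

text \<open>The quotient agrees with \<open>q\<close> away from \<open>c\<close>. As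
  \<open>- {c}\<close> is open, the agreement holds near \<open>x\<close> and so passes to
  derivatives.\<close>

lemma higher_deriv_poly_quotient:
  fixes f q :: "real poly"
  assumes "f = [:- c, 1:] * q" "x \<noteq> c"
  shows "(deriv ^^ j) (\<lambda>x. poly f x / (x - c)) x = poly ((pderiv ^^ j) q) x"
  using assms(2)
proof (induction j arbitrary: x)
  case 0
  have "poly f x = (x - c) * poly q x" by (simp add: assms(1) algebra_simps)
  with 0 show ?case by simp
next
  case (Suc j)
  have "\<forall>\<^sub>F y in nhds x. y \<in> - {c}"
    using Suc.prems by (intro eventually_nhds_in_open) auto
  then have "\<forall>\<^sub>F y in nhds x. (deriv ^^ j) (\<lambda>x. poly f x / (x - c)) y = poly ((pderiv ^^ j) q) y"
    by (rule eventually_mono) (use Suc.IH in auto)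
  then have "deriv ((deriv ^^ j) (\<lambda>x. poly f x / (x - c))) x = deriv (poly ((pderiv ^^ j) q)) x"
    by (intro deriv_cong_ev) auto
  also have "\<dots> = poly (pderiv ((pderiv ^^ j) q)) x"
    by (intro DERIV_imp_deriv poly_DERIV)
  finally show ?case by simp
qed

lemma coeff_zeck_poly:
  assumes "length L \<ge> 1"
  shows "coeff (zeck_poly L) i =
    (if i > length L then 0 else if i = length L then 1
     else - real (L ! (length L - 1 - i)) - (if i = 0 then 1 else 0))"
proof -
  define N where "N = length L"
  have "(\<Sum>k = 1..N - 1. coeff (monom (real (L ! (k - 1))) (N - k)) i)
      = (\<Sum>k = 1..N - 1. if k = N - i then real (L ! (k - 1)) else 0)" if "i \<le> N"
    using that by (intro sum.cong) (auto simp: N_def)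
  also have "\<dots> = (if 0 < i \<and> i < N then real (L ! (N - i - 1)) else 0)" if "i \<le> N"
    using that assms by (auto simp: N_def)
  moreover have "(\<Sum>k = 1..N - 1. coeff (monom (real (L ! (k - 1))) (N - k)) i) = 0" if "i > N"
    using that by (intro sum.neutral) auto
  ultimately show ?thesis
    using assms unfolding zeck_poly_def N_def[symmetric]
    by (cases "i \<le> N") (auto simp: coeff_sum coeff_pCons split: nat.splits)
qed

text \<open>In the defining sum for \<open>H (n + length L)\<close>, periodicity makes the terms
  below \<open>n\<close>, together with the 1, add up to \<open>H n\<close>; the other terms run
  backwards through one full period of \<open>beta_star L\<close>.\<close>

lemma fundamental_seq_recurrence:
  assumes "is_fundamental_seq L H" "1 \<le> n" "1 \<le> length L"
  shows "H (n + length L) = H n + (\<Sum>i<length L. L ! (length L - 1 - i) * H (n + i))"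
proof -
  define N where "N = length L"
  \<comment> \<open>At \<open>m = 1\<close> the sum is empty, which lets the recurrence start at
    \<open>n = 1\<close>.\<close>
  have H_eq: "H m = 1 + (\<Sum>k = 1..<m. beta_star L (m - k) * H k)" if "1 \<le> m" for m
    using assms(1) that by (cases "m = 1") (auto simp: is_fundamental_seq_def coeff_sum_theta)
  have periodic: "beta_star L (n + N - k) = beta_star L (n - k)" if "k \<in> {1..<n}" for k
  proof -
    have "n + N - k - 1 = n - k - 1 + N" using that by auto
    then show ?thesis using that by (simp add: beta_star_def N_def del: diff_diff_left)
  qed
  have "H (n + N) = 1 + (\<Sum>k = 1..<n + N. beta_star L (n + N - k) * H k)"
    using assms by (intro H_eq) simp
  also have "{1..<n + N} = {1..<n} \<union> {n..<n + N}" using assms by auto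
  also have "1 + (\<Sum>k\<in>\<dots>. beta_star L (n + N - k) * H k)
      = 1 + (\<Sum>k = 1..<n. beta_star L (n + N - k) * H k)
        + (\<Sum>k = n..<n + N. beta_star L (n + N - k) * H k)"
    by (subst sum.union_disjoint) auto
  also have "(\<Sum>k = 1..<n. beta_star L (n + N - k) * H k) = (\<Sum>k = 1..<n. beta_star L (n - k) * H k)"
    using periodic by simp
  also have "1 + \<dots> = H n" using H_eq assms by simp
  also have "(\<Sum>k = n..<n + N. beta_star L (n + N - k) * H k)
      = (\<Sum>i<N. L ! (N - 1 - i) * H (n + i))"
    by (rule sum.reindex_bij_witness[of _ "\<lambda>i. n + i" "\<lambda>k. k - n"])
      (auto simp: beta_star_def N_def add.commute)
  finally show ?thesis by (simp add: N_def)
qed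

section \<open>The limit for the periodic Zeckendorf collection\<close>

theorem theorem5p1:
  fixes L :: "nat list" and H :: "nat \<Rightarrow> nat" and N :: nat
    and f :: "real poly" and \<phi> :: real
  assumes N: "N = length L" "N \<ge> 2"
    and e1: "L ! 0 \<noteq> 0"
    and H: "is_fundamental_seq L H"
    and f: "f = zeck_poly L"
    and \<phi>: "\<phi> = pos_zero L"
  shows "((\<lambda>n. real (H n) / \<phi> ^ (n - 1)) \<longlonglongrightarrow>
            1 / poly (pderiv f) \<phi> *
            (\<Sum>k = 1..N. real (H k) / fact (k - 1) *
               (deriv ^^ (k - 1)) (\<lambda>x. poly f x / (x - \<phi>)) 0)) \<and>
         (\<forall>B :: real. B \<noteq> \<phi> \<longrightarrow> (\<forall>k\<in>{1..N}. real (H k) = B ^ (k - 1)) \<longrightarrow>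
            (\<lambda>n. real (H n) / \<phi> ^ (n - 1)) \<longlonglongrightarrow>
              poly f B / ((B - \<phi>) * poly (pderiv f) \<phi>))"
proof -
  have coeff_f: "coeff f i = (if i > N then 0 else if i = N then 1
     else - real (L ! (N - 1 - i)) - (if i = 0 then 1 else 0))" for i
    using coeff_zeck_poly[of L i] N f by simp
  have root: "0 < \<phi>" "poly f \<phi> = 0"
    using theI'[OF zeck_poly_ex1_pos_zero(1)[of L]] N e1 f \<phi> by (auto simp: pos_zero_def)
  then obtain q where q: "f = [:- \<phi>, 1:] * q"
    by (auto simp: poly_eq_0_iff_dvd dvd_def)
  have deg_f: "degree f = N"
    by (rule antisym) (auto intro!: degree_le le_degree simp: coeff_f)
  have deg_q: "degree q = N - 1"
    using deg_f degree_mult_eq[of "[:- \<phi>, 1:]" q] q N by (cases "q = 0") auto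
  \<comment> \<open>Shifting to indices from 0 turns the exponent \<open>n - 1\<close> into
    \<open>n\<close>.\<close>
  define h where "h n = real (H (Suc n))" for n
  have lim: "(\<lambda>n. h n / \<phi> ^ n) \<longlonglongrightarrow> (\<Sum>j<N. coeff q j * h j) / poly (pderiv f) \<phi>"
  proof (rule linear_recurrence_dominant_limit[OF _ deg_f _ _ _ _ q root(1)])
    show "(\<Sum>i\<le>N. coeff f i * h (n + i)) = 0" for n
    proof -
      have "(\<Sum>i<N. coeff f i * h (n + i))
          = - (\<Sum>i<N. real (L ! (N - 1 - i)) * h (n + i)) - (\<Sum>i<N. if i = 0 then h (n + i) else 0)"
        unfolding sum_negf[symmetric] sum_subtractf[symmetric]
        by (intro sum.cong) (auto simp: coeff_f algebra_simps)
      also have "(\<Sum>i<N. if i = 0 then h (n + i) else 0) = h n"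
        using N(2) by simp
      \<comment> \<open>The extra 1 in the constant term of \<open>f\<close> matches the summand
        \<open>H n\<close> of the recurrence.\<close>
      also have "- (\<Sum>i<N. real (L ! (N - 1 - i)) * h (n + i)) - h n = - h (n + N)"
        using fundamental_seq_recurrence[OF H, of "Suc n"] N by (simp add: h_def)
      finally show ?thesis by (simp add: coeff_f flip: lessThan_Suc_atMost)
    qed
  \<comment> \<open>The two strict signs come from the constant term \<open>-(1 + e_N)\<close> and
    from \<open>coeff f (N - 1) = - e_1\<close>, where \<open>e_1\<close> is nonzero.\<close>
  qed (use N e1 in \<open>auto simp: coeff_f\<close>)
  have lim': "(\<lambda>n. real (H n) / \<phi> ^ (n - 1)) \<longlonglongrightarrow>
      (\<Sum>j<N. coeff q j * h j) / poly (pderiv f) \<phi>"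
    by (rule LIMSEQ_imp_Suc) (use lim in \<open>simp add: h_def\<close>)
  \<comment> \<open>Since \<open>\<phi>\<close> is not 0, the quotient is \<open>q\<close> near 0,
    so its Taylor coefficients at 0 are those of \<open>q\<close>.\<close>
  have taylor: "(deriv ^^ j) (\<lambda>x. poly f x / (x - \<phi>)) 0 = fact j * coeff q j" for j
  proof -
    have "(deriv ^^ j) (\<lambda>x. poly f x / (x - \<phi>)) 0 = coeff ((pderiv ^^ j) q) 0"
      using higher_deriv_poly_quotient[OF q, of 0 j] root by (simp add: poly_0_coeff_0)
    also have "\<dots> = fact j * coeff q j"
      by (simp add: coeff_higher_pderiv pochhammer_fact)
    finally show ?thesis .
  qed
  have sum_eq: "(\<Sum>k = 1..N. real (H k) / fact (k - 1) *
      (deriv ^^ (k - 1)) (\<lambda>x. poly f x / (x - \<phi>)) 0) = (\<Sum>j<N. coeff q j * h j)"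
    by (rule sum.reindex_bij_witness[of _ Suc "\<lambda>k. k - 1"]) (auto simp: taylor h_def)
  show ?thesis
  proof (intro conjI allI impI)
    show "(\<lambda>n. real (H n) / \<phi> ^ (n - 1)) \<longlonglongrightarrow> 1 / poly (pderiv f) \<phi> *
        (\<Sum>k = 1..N. real (H k) / fact (k - 1) *
          (deriv ^^ (k - 1)) (\<lambda>x. poly f x / (x - \<phi>)) 0)"
      unfolding sum_eq using lim' by simp
  next
    fix B :: real
    assume B: "B \<noteq> \<phi>" "\<forall>k\<in>{1..N}. real (H k) = B ^ (k - 1)"
    \<comment> \<open>Geometric initial values turn the sum into the evaluation of \<open>q\<close>
      at \<open>B\<close>.\<close>
    have "(\<Sum>j<N. coeff q j * h j) = (\<Sum>j<N. coeff q j * B ^ j)"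
      using B(2) by (intro sum.cong) (auto simp: h_def)
    also have "\<dots> = poly q B"
      using N(2) by (simp add: poly_altdef deg_q flip: lessThan_Suc_atMost)
    also have "\<dots> = poly f B / (B - \<phi>)"
      using B(1) by (simp add: q field_simps)
    finally show "(\<lambda>n. real (H n) / \<phi> ^ (n - 1)) \<longlonglongrightarrow>
        poly f B / ((B - \<phi>) * poly (pderiv f) \<phi>)"
      using lim' by simp
  qed
qed

end
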